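(* Let $(X,\kappa_1,\kappa_2)$ be a bispace which is pairwise semi-$T_0$ and pairwise semi-$R_0$. Then $(X,\kappa_1,\kappa_2)$ is pairwise semi-$T_1$.
   Context: A $\sigma$-space $(X,\kappa)$ is a nonempty set $X$ with a family $\kappa$ of subsets of $X$ (the $\kappa$-open sets) such that $\emptyset,X\in\kappa$, and $\kappa$ is closed under countable unions and finite intersections; complements of $\kappa$-open sets are $\kappa$-closed. A bispace $(X,\kappa_1,\kappa_2)$ is a nonempty set $X$ with two families $\kappa_1,\kappa_2$ such that $(X,\kappa_1)$ and $(X,\kappa_2)$ are $\sigma$-spaces. For $i\in\{1,2\}$, the $\kappa_i$-closure $\overline{G_{\kappa_i}}$ of $G\subseteq X$ is the intersection of all $\kappa_i$-closed sets containing $G$ (it need not be $\kappa_i$-closed). A set $B\subseteq X$ is $s\kappa_i$-open (semi $\kappa_i$-open) if there is a $\kappa_i$-open set $G$ with $G\subseteq B\subseteq\overline{G_{\kappa_i}}$; $B$ is $s\kappa_i$-closed if $X\setminus B$ is $s\kappa_i$-open. The semi $\kappa_i$-closure $\overline{sB_{\kappa_i}}$ of $B$ is the intersection of all $s\kappa_i$-closed sets containing $B$ (it need not be $s\kappa_i$-closed). Pairwise semi-$T_0$: for all $x,y\in X$ with $x\neq y$, either there is an $s\kappa_1$-open set $U$ with $x\in U$, $y\notin U$, or there is an $s\kappa_2$-open set $V$ with $y\in V$, $x\notin V$. Pairwise semi-$T_1$: for all $x,y\in X$ with $x\neq y$ there exist an $s\kappa_1$-open set $U$ and an $s\kappa_2$-open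 set $V$ such that $x\in U$, $y\notin U$, $y\in V$, $x\notin V$. Pairwise semi-$R_0$: for all $i,j\in\{1,2\}$ with $i\neq j$, and every $s\kappa_i$-open set $U$, $x\in U$ implies $\overline{s\{x\}_{\kappa_j}}\subseteq U$. *)

theory Defs
  imports "HOL-Library.Countable_Set"
begin

definition sigma_space :: "'a set \<Rightarrow> 'a set set \<Rightarrow> bool" where
  "sigma_space X \<kappa> \<longleftrightarrow>
     X \<noteq> {} \<and> \<kappa> \<subseteq> Pow X \<and> {} \<in> \<kappa> \<and> X \<in> \<kappa> \<and>
     (\<forall>\<A>. countable \<A> \<and> \<A> \<subseteq> \<kappa> \<longrightarrow> \<Union>\<A> \<in> \<kappa>) \<and>
     (\<forall>\<A>. finite \<A> \<and> \<A> \<noteq> {} \<and> \<A> \<subseteq> \<kappa> \<longrightarrow> \<Inter>\<A> \<in> \<kappa>)"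

definition bispace :: "'a set \<Rightarrow> 'a set set \<Rightarrow> 'a set set \<Rightarrow> bool" where
  "bispace X \<kappa>1 \<kappa>2 \<longleftrightarrow> sigma_space X \<kappa>1 \<and> sigma_space X \<kappa>2"

definition k_closed :: "'a set \<Rightarrow> 'a set set \<Rightarrow> 'a set \<Rightarrow> bool" where
  "k_closed X \<kappa> F \<longleftrightarrow> F \<subseteq> X \<and> X - F \<in> \<kappa>"

text \<open>
  In a \<open>\<sigma>\<close>-space, \<open>X\<close> is closed and semi-closed, so for subsets of \<open>X\<close> the intersections
  defining the two closures below range over nonempty families. Neither closure need itself
  be (semi-)closed.
\<close>

definition k_closure :: "'a set \<Rightarrow> 'a set set \<Rightarrow> 'a set \<Rightarrow> 'a set" where
  "k_closure X \<kappa> G = \<Inter>{F. k_closed X \<kappa> F \<and> G \<subseteq> F}"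

definition semi_open :: "'a set \<Rightarrow> 'a set set \<Rightarrow> 'a set \<Rightarrow> bool" where
  "semi_open X \<kappa> B \<longleftrightarrow> B \<subseteq> X \<and> (\<exists>G\<in>\<kappa>. G \<subseteq> B \<and> B \<subseteq> k_closure X \<kappa> G)"

definition semi_closed :: "'a set \<Rightarrow> 'a set set \<Rightarrow> 'a set \<Rightarrow> bool" where
  "semi_closed X \<kappa> B \<longleftrightarrow> B \<subseteq> X \<and> semi_open X \<kappa> (X - B)"

definition semi_closure :: "'a set \<Rightarrow> 'a set set \<Rightarrow> 'a set \<Rightarrow> 'a set" where
  "semi_closure X \<kappa> B = \<Inter>{F. semi_closed X \<kappa> F \<and> B \<subseteq> F}"

text \<open>
  The \<open>T\<^sub>0\<close> condition ties \<open>x\<close> to \<open>\<kappa>1\<close> and \<open>y\<close> to \<open>\<kappa>2\<close>; since it is required of all ordered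
  pairs of distinct points, it also holds with \<open>x\<close> and \<open>y\<close> exchanged.
\<close>

definition pairwise_semi_T0 :: "'a set \<Rightarrow> 'a set set \<Rightarrow> 'a set set \<Rightarrow> bool" where
  "pairwise_semi_T0 X \<kappa>1 \<kappa>2 \<longleftrightarrow>
     (\<forall>x\<in>X. \<forall>y\<in>X. x \<noteq> y \<longrightarrow>
        (\<exists>U. semi_open X \<kappa>1 U \<and> x \<in> U \<and> y \<notin> U) \<or>
        (\<exists>V. semi_open X \<kappa>2 V \<and> y \<in> V \<and> x \<notin> V))"

definition pairwise_semi_T1 :: "'a set \<Rightarrow> 'a set set \<Rightarrow> 'a set set \<Rightarrow> bool" where
  "pairwise_semi_T1 X \<kappa>1 \<kappa>2 \<longleftrightarrow>
     (\<forall>x\<in>X. \<forall>y\<in>X. x \<noteq> y \<longrightarrow>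
        (\<exists>U V. semi_open X \<kappa>1 U \<and> semi_open X \<kappa>2 V \<and>
               x \<in> U \<and> y \<notin> U \<and> y \<in> V \<and> x \<notin> V))"

definition pairwise_semi_R0 :: "'a set \<Rightarrow> 'a set set \<Rightarrow> 'a set set \<Rightarrow> bool" where
  "pairwise_semi_R0 X \<kappa>1 \<kappa>2 \<longleftrightarrow>
     (\<forall>U x. semi_open X \<kappa>1 U \<and> x \<in> U \<longrightarrow> semi_closure X \<kappa>2 {x} \<subseteq> U) \<and>
     (\<forall>U x. semi_open X \<kappa>2 U \<and> x \<in> U \<longrightarrow> semi_closure X \<kappa>1 {x} \<subseteq> U)"

end

theory Submission
  imports Defs
begin

text \<open>
  Each alternative of pairwise semi-\<open>T\<^sub>0\<close> yields one half of \<open>T\<^sub>1\<close>, and \<open>R\<^sub>0\<close> converts it into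
  the other half: if a semi-open \<open>U\<close> of one family contains \<open>x\<close> but not \<open>y\<close>, then the
  semi-closure of \<open>{x}\<close> in the other family lies inside \<open>U\<close> and so misses \<open>y\<close>. That semi-closure
  need not be semi-closed, so its complement may fail to be semi-open; but a point outside an
  intersection is outside one of its members, and the complement of that single semi-closed set
  separates \<open>y\<close> from \<open>x\<close>.
\<close>

lemma semi_open_separates_from_semi_closure:
  assumes "y \<in> X" and "y \<notin> semi_closure X \<kappa> A"
  obtains V where "semi_open X \<kappa> V" "y \<in> V" "V \<inter> A = {}"
proof -
  obtain F where F: "semi_closed X \<kappa> F" "A \<subseteq> F" "y \<notin> F"
    using assms(2) unfolding semi_closure_def by blast
  show thesis
  proof (rule that)
    show "semi_open X \<kappa> (X - F)" using F(1) by (simp add: semi_closed_def)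
    show "y \<in> X - F" using assms(1) F(3) by simp
    show "(X - F) \<inter> A = {}" using F(2) by blast
  qed
qed

theorem theorem3p15:
  fixes X :: "'a set" and \<kappa>1 \<kappa>2 :: "'a set set"
  assumes "bispace X \<kappa>1 \<kappa>2"
    and "pairwise_semi_T0 X \<kappa>1 \<kappa>2"
    and "pairwise_semi_R0 X \<kappa>1 \<kappa>2"
  shows "pairwise_semi_T1 X \<kappa>1 \<kappa>2"
  unfolding pairwise_semi_T1_def
proof (intro ballI impI)
  fix x y
  assume x: "x \<in> X" and y: "y \<in> X" and "x \<noteq> y"
  then consider
      (first) U where "semi_open X \<kappa>1 U" "x \<in> U" "y \<notin> U"
    | (second) V where "semi_open X \<kappa>2 V" "y \<in> V" "x \<notin> V"
    using assms(2) unfolding pairwise_semi_T0_def by blast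
  then show "\<exists>U V. semi_open X \<kappa>1 U \<and> semi_open X \<kappa>2 V \<and>
               x \<in> U \<and> y \<notin> U \<and> y \<in> V \<and> x \<notin> V"
  proof cases
    case first
    then have "y \<notin> semi_closure X \<kappa>2 {x}"
      using assms(3) unfolding pairwise_semi_R0_def by blast
    with y obtain V where "semi_open X \<kappa>2 V" "y \<in> V" "V \<inter> {x} = {}"
      by (rule semi_open_separates_from_semi_closure)
    with first show ?thesis by blast
  next
    case second
    then have "x \<notin> semi_closure X \<kappa>1 {y}"
      using assms(3) unfolding pairwise_semi_R0_def by blast
    with x obtain U where "semi_open X \<kappa>1 U" "x \<in> U" "U \<inter> {y} = {}"
      by (rule semi_open_separates_from_semi_closure)
    with second show ?thesis by blast
  qed
qed

end
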